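(* Let $r\in\mathbb{R}$. Then $\{r^k\}_{k=0}^{\infty}$ is a multiplier sequence for the Chebyshev basis if and only if $r\in\{-1,0,1\}$.
   Context: A polynomial in $\mathbb{R}[x]$ is hyperbolic if it either has only real zeros or is identically zero (nonzero constants, having no zeros, are hyperbolic). A linear operator $K$ on $\mathbb{R}[x]$ is hyperbolicity preserving if $K(p)$ is hyperbolic whenever $p$ is hyperbolic. The Chebyshev polynomials (of the first kind) $\{T_k\}_{k=0}^\infty$ are the unique polynomials satisfying $T_k(\cos\theta)=\cos(k\theta)$; they form a basis of $\mathbb{R}[x]$. A sequence of real numbers $\{\gamma_k\}_{k=0}^\infty$ is a multiplier sequence for the Chebyshev basis if the linear operator $K$ on $\mathbb{R}[x]$ determined by $K[\sum_{k=0}^{m} a_kT_k(x)]=\sum_{k=0}^{m}\gamma_k a_kT_k(x)$ is hyperbolicity preserving. Convention: $0^0=1$. *)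

theory Defs
  imports "HOL-Analysis.Analysis" "HOL-Computational_Algebra.Polynomial"
begin

definition hyperbolic :: "real poly \<Rightarrow> bool" where
  "hyperbolic p \<longleftrightarrow>
     p = 0 \<or> (\<forall>z::complex. poly (map_poly complex_of_real p) z = 0 \<longrightarrow> z \<in> \<real>)"

definition hyperbolicity_preserving :: "(real poly \<Rightarrow> real poly) \<Rightarrow> bool" where
  "hyperbolicity_preserving K \<longleftrightarrow> (\<forall>p. hyperbolic p \<longrightarrow> hyperbolic (K p))"

definition chebyshev_T :: "nat \<Rightarrow> real poly" where
  "chebyshev_T k = (THE p. \<forall>\<theta>::real. poly p (cos \<theta>) = cos (real k * \<theta>))"

definition chebyshev_diagonal_operator :: "(nat \<Rightarrow> real) \<Rightarrow> real poly \<Rightarrow> real poly" where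
  "chebyshev_diagonal_operator \<gamma> =
     (THE K. Vector_Spaces.linear smult smult K \<and>
        (\<forall>m (a :: nat \<Rightarrow> real).
           K (\<Sum>k\<le>m. smult (a k) (chebyshev_T k)) = (\<Sum>k\<le>m. smult (\<gamma> k * a k) (chebyshev_T k))))"

definition chebyshev_multiplier_sequence :: "(nat \<Rightarrow> real) \<Rightarrow> bool" where
  "chebyshev_multiplier_sequence \<gamma> \<longleftrightarrow>
     hyperbolicity_preserving (chebyshev_diagonal_operator \<gamma>)"

text \<open>Both definite descriptions denote: see \<open>chebyshev_T_exists\<close> with
  \<open>chebyshev_T_unique\<close>, and \<open>chebyshev_diagonal_operator_ex1\<close>.\<close>

lemma chebyshev_T_unique:
  fixes p q :: "real poly"
  assumes "\<And>\<theta>. poly p (cos \<theta>) = poly q (cos \<theta>)"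
  shows "p = q"
proof -
  have "{-1..1::real} \<subseteq> {x. poly (p - q) x = 0}"
  proof
    fix x :: real assume "x \<in> {-1..1}"
    then have "cos (arccos x) = x" by simp
    then show "x \<in> {x. poly (p - q) x = 0}"
      using assms[of "arccos x"] by simp
  qed
  moreover have "infinite {-1..1::real}" by simp
  ultimately have "infinite {x. poly (p - q) x = 0}"
    using finite_subset by blast
  then show ?thesis using poly_roots_finite[of "p - q"] by force
qed

lemma chebyshev_T_exists:
  "\<exists>p::real poly. (\<forall>\<theta>. poly p (cos \<theta>) = cos (real k * \<theta>)) \<and> degree p = k"
proof (induction k rule: less_induct)
  case (less k)
  consider "k = 0" | "k = 1" | n where "k = Suc (Suc n)"
    by (metis One_nat_def not0_implies_Suc)
  then show ?case
  proof cases
    case 1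
    then show ?thesis by (intro exI[of _ 1]) simp
  next
    case 2
    then show ?thesis by (intro exI[of _ "[:0, 1:]"]) simp
  next
    case 3
    from less[of n] less[of "Suc n"] 3 obtain p q :: "real poly" where
      p: "\<And>\<theta>. poly p (cos \<theta>) = cos (real n * \<theta>)" "degree p = n" and
      q: "\<And>\<theta>. poly q (cos \<theta>) = cos (real (Suc n) * \<theta>)" "degree q = Suc n"
      by auto
    let ?s = "[:0, 2:] * q - p"
    have q0: "q \<noteq> 0" using q(2) by auto
    have "degree ([:0, 2:] * q) = k"
      using q0 q(2) 3 by (subst degree_mult_eq) auto
    then have "degree ?s = k"
      using p(2) 3 by (metis degree_add_eq_left degree_minus diff_conv_add_uminus less_Suc_eq)
    moreover have "poly ?s (cos \<theta>) = cos (real k * \<theta>)" for \<theta>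
    proof -
      have "cos (real k * \<theta>) + cos (real n * \<theta>) = 2 * cos \<theta> * cos (real (Suc n) * \<theta>)"
      proof -
        have a: "real k * \<theta> = real (Suc n) * \<theta> + \<theta>" "real n * \<theta> = real (Suc n) * \<theta> - \<theta>"
          using 3 by (simp_all add: algebra_simps)
        show ?thesis unfolding a cos_add cos_diff by simp
      qed
      then show ?thesis using p q by simp
    qed
    ultimately show ?thesis by blast
  qed
qed

lemma chebyshev_T_properties:
  shows poly_chebyshev_T_cos: "poly (chebyshev_T k) (cos \<theta>) = cos (real k * \<theta>)"
    and degree_chebyshev_T: "degree (chebyshev_T k) = k"
proof -
  obtain p :: "real poly" where
    p: "\<forall>\<theta>. poly p (cos \<theta>) = cos (real k * \<theta>)" "degree p = k"
    using chebyshev_T_exists by blast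
  have "chebyshev_T k = p"
    unfolding chebyshev_T_def
    by (rule the_equality) (use p chebyshev_T_unique in auto)
  then show "poly (chebyshev_T k) (cos \<theta>) = cos (real k * \<theta>)" "degree (chebyshev_T k) = k"
    using p by auto
qed

lemma chebyshev_T_nonzero: "chebyshev_T k \<noteq> 0"
  using poly_chebyshev_T_cos[of k 0] by auto

lemma coeff_chebyshev_sum_top:
  "coeff (\<Sum>k\<le>m. smult (a k) (chebyshev_T k)) m = a m * lead_coeff (chebyshev_T m)"
proof -
  have "coeff (\<Sum>k\<le>m. smult (a k) (chebyshev_T k)) m = (\<Sum>k\<le>m. a k * coeff (chebyshev_T k) m)"
    by (simp add: coeff_sum)
  also have "\<dots> = (\<Sum>k\<le>m. if k = m then a m * lead_coeff (chebyshev_T m) else 0)"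
    by (rule sum.cong) (auto simp: degree_chebyshev_T coeff_eq_0)
  finally show ?thesis by simp
qed

lemma chebyshev_sum_eq_0:
  assumes "(\<Sum>k\<le>m. smult (a k) (chebyshev_T k)) = 0" "k \<le> m"
  shows "a k = 0"
  using assms
proof (induction m)
  case 0
  then show ?case using chebyshev_T_nonzero by simp
next
  case (Suc m)
  have "a (Suc m) * lead_coeff (chebyshev_T (Suc m)) = 0"
    using coeff_chebyshev_sum_top[of a "Suc m"] unfolding Suc.prems(1) by (metis coeff_0)
  moreover have "lead_coeff (chebyshev_T (Suc m)) \<noteq> 0"
    using chebyshev_T_nonzero by (metis leading_coeff_0_iff)
  ultimately have "a (Suc m) = 0" by (metis mult_eq_0_iff)
  with Suc show ?case by (cases "k = Suc m") auto
qed

lemma chebyshev_sum_exists: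
  "degree p \<le> m \<Longrightarrow> \<exists>a. p = (\<Sum>k\<le>m. smult (a k) (chebyshev_T k))"
proof (induction m arbitrary: p)
  case 0
  have d: "degree (chebyshev_T 0) = 0" by (rule degree_chebyshev_T)
  then obtain t where t: "chebyshev_T 0 = [:t:]" by (metis degree_eq_zeroE)
  from 0 obtain c where c: "p = [:c:]" by (metis degree_eq_zeroE le_zero_eq)
  have "t \<noteq> 0" using t chebyshev_T_nonzero[of 0] by auto
  then show ?case using t c by (intro exI[of _ "\<lambda>_. c / t"]) simp
next
  case (Suc m)
  let ?T = "chebyshev_T (Suc m)"
  define c where "c = coeff p (Suc m) / lead_coeff ?T"
  have lc: "coeff ?T (Suc m) \<noteq> 0"
    using chebyshev_T_nonzero[of "Suc m"] degree_chebyshev_T[of "Suc m"] by (metis leading_coeff_0_iff)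
  have "degree (p - smult c ?T) \<le> m"
  proof (rule degree_le, intro allI impI)
    fix i assume "m < i"
    then consider "i = Suc m" | "i > Suc m" by linarith
    then show "coeff (p - smult c ?T) i = 0"
    proof cases
      case 1
      then show ?thesis using lc by (simp add: c_def degree_chebyshev_T)
    next
      case 2
      then show ?thesis using Suc.prems by (simp add: coeff_eq_0 degree_chebyshev_T)
    qed
  qed
  from Suc.IH[OF this] obtain a where
    a: "p - smult c ?T = (\<Sum>k\<le>m. smult (a k) (chebyshev_T k))" by blast
  have "(\<Sum>k\<le>Suc m. smult ((a(Suc m := c)) k) (chebyshev_T k)) = p"
    using a by (simp add: algebra_simps)
  then show ?case by metis
qed

lemma chebyshev_diagonal_operator_ex1:
  "\<exists>!K. Vector_Spaces.linear smult smult K \<and>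
      (\<forall>m (a :: nat \<Rightarrow> real).
         K (\<Sum>k\<le>m. smult (a k) (chebyshev_T k)) = (\<Sum>k\<le>m. smult (\<gamma> k * a k) (chebyshev_T k)))"
proof -
  define S where "S m a = (\<Sum>k\<le>m. smult (a k) (chebyshev_T k))" for m :: nat and a :: "nat \<Rightarrow> real"
  have S_ext: "S n (\<lambda>k. if k \<le> m then a k else 0) = S m a" if "m \<le> n" for m n a
  proof -
    have "S m a = (\<Sum>k\<le>m. smult (if k \<le> m then a k else 0) (chebyshev_T k))"
      unfolding S_def by (rule sum.cong) auto
    also have "\<dots> = S n (\<lambda>k. if k \<le> m then a k else 0)"
      unfolding S_def using that by (intro sum.mono_neutral_left) auto
    finally show ?thesis by simp
  qed
  have S_add: "S m a + S m b = S m (\<lambda>k. a k + b k)" for m a b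
    by (simp add: S_def smult_add_left sum.distrib)
  have S_smult: "smult c (S m a) = S m (\<lambda>k. c * a k)" for c m a
    by (induction m) (simp_all add: S_def smult_add_right)
  have S_inj: "a k = b k" if "S m a = S m b" "k \<le> m" for m a b k
  proof -
    have "S m (\<lambda>k. a k - b k) = S m a - S m b"
      by (simp add: S_def smult_diff_left sum_subtractf)
    with that have "(\<Sum>k\<le>m. smult (a k - b k) (chebyshev_T k)) = 0"
      by (simp add: S_def)
    from chebyshev_sum_eq_0[OF this that(2)] show ?thesis by simp
  qed
  have "\<exists>a. p = S (degree p) a" for p
    unfolding S_def by (rule chebyshev_sum_exists) simp
  then obtain c where c: "\<And>p. p = S (degree p) (c p)" by metis
  define K where "K p = S (degree p) (\<lambda>k. \<gamma> k * c p k)" for p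
  have K: "K (S m a) = S m (\<lambda>k. \<gamma> k * a k)" for m a
  proof -
    define p where "p = S m a"
    define n where "n = max m (degree p)"
    let ?a = "\<lambda>k. if k \<le> m then a k else 0"
    let ?c = "\<lambda>k. if k \<le> degree p then c p k else 0"
    have "S n ?a = p" using S_ext[of m n a] by (simp add: n_def p_def)
    moreover have "S n ?c = p" using S_ext[of "degree p" n "c p"] c[of p] by (simp add: n_def)
    ultimately have eq: "?a k = ?c k" if "k \<le> n" for k
      using S_inj[of n ?a ?c k] that by simp
    have "K p = S n (\<lambda>k. if k \<le> degree p then \<gamma> k * c p k else 0)"
      unfolding K_def by (rule S_ext[symmetric]) (simp add: n_def)
    also have "\<dots> = S n (\<lambda>k. \<gamma> k * ?c k)"
      unfolding S_def by (rule sum.cong) auto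
    also have "\<dots> = S n (\<lambda>k. \<gamma> k * ?a k)"
      unfolding S_def by (rule sum.cong) (auto simp: eq)
    also have "\<dots> = S n (\<lambda>k. if k \<le> m then \<gamma> k * a k else 0)"
      unfolding S_def by (rule sum.cong) auto
    also have "\<dots> = S m (\<lambda>k. \<gamma> k * a k)"
      by (rule S_ext) (simp add: n_def)
    finally show ?thesis by (simp add: p_def)
  qed
  have rep: "\<exists>m a b. p = S m a \<and> q = S m b" for p q
    using chebyshev_sum_exists[of p "max (degree p) (degree q)"]
      chebyshev_sum_exists[of q "max (degree p) (degree q)"]
    unfolding S_def by (metis max.cobounded1 max.cobounded2)
  have "K (p + q) = K p + K q" for p q
  proof -
    obtain m a b where "p = S m a" "q = S m b" using rep by blast
    then show ?thesis by (simp add: S_add K distrib_left)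
  qed
  moreover have "K (smult r p) = smult r (K p)" for r p
  proof -
    obtain m a where "p = S m a" using c by blast
    then show ?thesis by (simp add: S_smult K mult.left_commute)
  qed
  ultimately have lin: "Vector_Spaces.linear smult smult K"
    by unfold_locales (auto simp: smult_add_right smult_add_left)
  show ?thesis
  proof (rule ex1I[of _ K])
    show "Vector_Spaces.linear smult smult K \<and>
      (\<forall>m a. K (\<Sum>k\<le>m. smult (a k) (chebyshev_T k)) = (\<Sum>k\<le>m. smult (\<gamma> k * a k) (chebyshev_T k)))"
      using lin K by (simp add: S_def)
  next
    fix L
    assume L: "Vector_Spaces.linear smult smult L \<and>
      (\<forall>m a. L (\<Sum>k\<le>m. smult (a k) (chebyshev_T k)) = (\<Sum>k\<le>m. smult (\<gamma> k * a k) (chebyshev_T k)))"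
    show "L = K"
    proof
      fix p
      obtain m a where "p = S m a" using c by blast
      then show "L p = K p" using L K by (simp add: S_def)
    qed
  qed
qed

lemma linear_chebyshev_diagonal_operator:
  "Vector_Spaces.linear smult smult (chebyshev_diagonal_operator \<gamma>)"
  and chebyshev_diagonal_operator_sum:
  "chebyshev_diagonal_operator \<gamma> (\<Sum>k\<le>m. smult (a k) (chebyshev_T k)) =
     (\<Sum>k\<le>m. smult (\<gamma> k * a k) (chebyshev_T k))"
  using theI'[OF chebyshev_diagonal_operator_ex1[of \<gamma>]]
  unfolding chebyshev_diagonal_operator_def by blast+

end

theory Submission
  imports Defs "HOL-Computational_Algebra.Fundamental_Theorem_Algebra"
begin

text \<open>
  For \<open>r = 1\<close>, \<open>r = 0\<close> and \<open>r = -1\<close> the diagonal operator is respectively the identity, the projection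
  onto the constants, and the reflection \<open>p(x) \<mapsto> p(-x)\<close> (because \<open>T\<^sub>k\<close> has the parity of \<open>k\<close>). Each of
  these plainly preserves hyperbolicity.

  For any other \<open>r\<close> the single cubic \<open>(x + r)\<^sup>3\<close> is a counterexample. Expanding \<open>(x + a)\<^sup>3\<close> in the
  Chebyshev basis, applying the operator and putting \<open>Y = r x + a\<close>, one finds
  \<open>Y\<^sup>3 - 3/4 (r\<^sup>2 - 1) (Y + a)\<close>. This depressed cubic has discriminant
  \<open>27/16 (r\<^sup>2 - 1)\<^sup>2 (r\<^sup>2 - 1 - 9 a\<^sup>2)\<close>, which is negative as soon as \<open>9 a\<^sup>2 > r\<^sup>2 - 1\<close>; the choice
  \<open>a = r\<close> achieves this for all \<open>r\<close> at once. With \<open>Y = r u\<close>, that is \<open>u = x + 1\<close>, the image becomes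
  \<open>r\<^sup>3 (u\<^sup>3 - m (u + 1))\<close> where \<open>m = 3/4 (1 - 1/r\<^sup>2)\<close> is nonzero and below \<open>3/4\<close>. Lemma
  \<open>depressed_cubic_nonreal_root\<close> shows directly that such a cubic has a nonreal zero.
\<close>

lemma hyperbolic_const: "hyperbolic [:c:]"
  by (auto simp: hyperbolic_def map_poly_pCons)

lemma chebyshev_T_0: "chebyshev_T 0 = 1"
  by (rule chebyshev_T_unique) (simp add: poly_chebyshev_T_cos)

lemma chebyshev_T_1: "chebyshev_T 1 = [:0, 1:]"
  by (rule chebyshev_T_unique) (simp add: poly_chebyshev_T_cos)

lemma chebyshev_T_2: "chebyshev_T 2 = [:-1, 0, 2:]"
  by (rule chebyshev_T_unique)
    (simp add: poly_chebyshev_T_cos cos_double_cos power2_eq_square)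

lemma chebyshev_T_3: "chebyshev_T 3 = [:0, -3, 0, 4:]"
  by (rule chebyshev_T_unique)
    (simp add: poly_chebyshev_T_cos cos_treble_cos mult.commute[of _ 3] power3_eq_cube right_diff_distrib)

text \<open>Parity, read off from \<open>- cos \<theta> = cos (\<pi> - \<theta>)\<close>.\<close>

lemma chebyshev_T_reflect:
  "pcompose (chebyshev_T k) [:0, -1:] = smult ((-1) ^ k) (chebyshev_T k)"
proof (rule chebyshev_T_unique)
  fix \<theta> :: real
  have "poly (pcompose (chebyshev_T k) [:0, -1:]) (cos \<theta>) = poly (chebyshev_T k) (cos (pi - \<theta>))"
    by (simp add: poly_pcompose)
  also have "\<dots> = cos (real k * pi - real k * \<theta>)"
    by (simp only: poly_chebyshev_T_cos right_diff_distrib)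
  also have "\<dots> = (-1) ^ k * cos (real k * \<theta>)"
    by (simp add: cos_diff)
  finally show "poly (pcompose (chebyshev_T k) [:0, -1:]) (cos \<theta>)
      = poly (smult ((-1) ^ k) (chebyshev_T k)) (cos \<theta>)"
    by (simp add: poly_chebyshev_T_cos)
qed

lemma chebyshev_diagonal_operator_one: "chebyshev_diagonal_operator (\<lambda>k. 1 ^ k) p = p"
proof -
  obtain a where a: "p = (\<Sum>k\<le>degree p. smult (a k) (chebyshev_T k))"
    using chebyshev_sum_exists by blast
  show ?thesis
    by (subst (1 2) a, subst chebyshev_diagonal_operator_sum) simp
qed

lemma chebyshev_diagonal_operator_zero:
  "\<exists>c. chebyshev_diagonal_operator (\<lambda>k. 0 ^ k) p = [:c:]"
proof -
  obtain a where a: "p = (\<Sum>k\<le>degree p. smult (a k) (chebyshev_T k))"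
    using chebyshev_sum_exists by blast
  have "chebyshev_diagonal_operator (\<lambda>k. 0 ^ k) p
      = (\<Sum>k\<le>degree p. smult (0 ^ k * a k) (chebyshev_T k))"
    by (subst (1) a, rule chebyshev_diagonal_operator_sum)
  also have "\<dots> = (\<Sum>k\<le>degree p. if k = 0 then [:a 0:] else 0)"
    by (rule sum.cong) (auto simp: chebyshev_T_0 one_pCons)
  finally show ?thesis by simp
qed

lemma chebyshev_diagonal_operator_minus_one:
  "chebyshev_diagonal_operator (\<lambda>k. (-1) ^ k) p = pcompose p [:0, -1:]"
proof -
  obtain a where a: "p = (\<Sum>k\<le>degree p. smult (a k) (chebyshev_T k))"
    using chebyshev_sum_exists by blast
  show ?thesis
    by (subst (1 2) a, subst chebyshev_diagonal_operator_sum)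
      (simp add: pcompose_sum pcompose_smult chebyshev_T_reflect mult.commute)
qed

lemma hyperbolic_reflect:
  assumes "hyperbolic p"
  shows "hyperbolic (pcompose p [:0, -1:])"
proof -
  have uminus: "map_poly complex_of_real (- q) = - map_poly complex_of_real q" for q
    by (rule poly_eqI) (simp add: coeff_map_poly)
  have reflect: "poly (map_poly complex_of_real (pcompose p [:0, -1:])) z
      = poly (map_poly complex_of_real p) (- z)" for z
    by (induction p) (simp_all add: pcompose_pCons map_poly_pCons uminus)
  have "z \<in> \<real>" if "- z \<in> \<real>" for z :: complex
    using Reals_minus[OF that] by simp
  then show ?thesis
    using assms unfolding hyperbolic_def reflect by auto
qed

text \<open>
  At a real zero \<open>w\<close> the cubic \<open>u\<^sup>3 - m (u + 1)\<close> splits off the quadratic \<open>u\<^sup>2 + w u + (w\<^sup>2 - m)\<close>, of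
  discriminant \<open>4 m - 3 w\<^sup>2\<close>. If this were nonnegative, then \<open>w\<^sup>2 \<le> 4/3 m < 1\<close>, so that \<open>w + 1 > 0\<close> and
  \<open>w\<^sup>3 = m (w + 1) \<ge> 3/4 w\<^sup>2 (w + 1)\<close>, which, as
  \<open>w \<noteq> 0\<close> because \<open>m \<noteq> 0\<close>, forces \<open>w \<ge> 3\<close>, a contradiction.
\<close>

lemma depressed_cubic_nonreal_root:
  fixes m :: real
  assumes "m \<noteq> 0" "m < 3/4"
  obtains u :: complex where "u ^ 3 = of_real m * (u + 1)" "u \<notin> \<real>"
proof (cases "\<exists>u::complex. u \<notin> \<real> \<and> u ^ 3 = of_real m * (u + 1)")
  case True
  then show ?thesis using that by blast
next
  case False
  have "\<not> constant (poly [:- of_real m, - of_real m, 0, 1 :: complex:])"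
    by (simp add: constant_degree)
  then obtain z where "poly [:- of_real m, - of_real m, 0, 1 :: complex:] z = 0"
    using fundamental_theorem_of_algebra by blast
  then have "z ^ 3 = of_real m * (z + 1)"
    by (simp add: power3_eq_cube algebra_simps)
  with False obtain w where "z = of_real w" "z ^ 3 = of_real m * (z + 1)"
    by (metis Reals_cases)
  then have w: "w ^ 3 = m * (w + 1)"
    by (metis of_real_1 of_real_add of_real_eq_iff of_real_mult of_real_power)
  have disc: "4 * m < 3 * w\<^sup>2"
  proof (rule ccontr)
    assume "\<not> 4 * m < 3 * w\<^sup>2"
    then have le: "3/4 * w\<^sup>2 \<le> m" by simp
    have "w \<noteq> 0" using w assms(1) by auto
    have "w\<^sup>2 < 1" using le assms(2) by simp
    then have "\<bar>w\<bar> < 1" by (simp add: abs_square_less_1)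
    then have "3/4 * w\<^sup>2 * (w + 1) \<le> w ^ 3"
      using mult_right_mono[OF le, of "w + 1"] w by simp
    then have "w\<^sup>2 * (3/4 * (w + 1)) \<le> w\<^sup>2 * w"
      by (simp add: power2_eq_square power3_eq_cube mult.assoc mult.left_commute)
    then have "3/4 * (w + 1) \<le> w"
      using \<open>w \<noteq> 0\<close> by (simp add: mult_le_cancel_left_pos)
    then show False using \<open>\<bar>w\<bar> < 1\<close> by simp
  qed
  define s where "s = sqrt (3 * w\<^sup>2 - 4 * m)"
  have s: "s\<^sup>2 = 3 * w\<^sup>2 - 4 * m" "s > 0" using disc by (auto simp: s_def)
  (* A zero of the quadratic cofactor of u - w. *)
  define u where "u = Complex (- w / 2) (s / 2)"
  have quad: "u\<^sup>2 + of_real w * u + of_real (w\<^sup>2 - m) = 0"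
    using s(1) by (simp add: u_def complex_eq_iff power2_eq_square field_simps)
  have cw: "(of_real w :: complex) ^ 3 = of_real m * (of_real w + 1)"
    using w by (metis of_real_1 of_real_add of_real_mult of_real_power)
  have "u ^ 3 - of_real m * (u + 1)
      = (u - of_real w) * (u\<^sup>2 + of_real w * u + of_real (w\<^sup>2 - m))
        + (of_real w ^ 3 - of_real m * (of_real w + 1))"
    by (simp add: power2_eq_square power3_eq_cube algebra_simps)
  then have "u ^ 3 = of_real m * (u + 1)" unfolding quad cw by simp
  moreover have "u \<notin> \<real>" using s(2) by (simp add: u_def complex_is_Real_iff)
  ultimately show ?thesis using that by blast
qed

lemma chebyshev_diagonal_operator_cube:
  fixes r :: real
  shows "chebyshev_diagonal_operator (\<lambda>k. r ^ k) ([:a, 1:] ^ 3)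
    = [:a ^ 3 - 3/2 * a * (r\<^sup>2 - 1), 3 * a\<^sup>2 * r - 3/4 * r * (r\<^sup>2 - 1), 3 * a * r\<^sup>2, r ^ 3:]"
proof -
  (* The Chebyshev coefficients of (x + a)^3, from x^2 = (T_2 + T_0) / 2 and x^3 = (T_3 + 3 T_1) / 4. *)
  let ?c = "\<lambda>k. [a ^ 3 + 3/2 * a, 3 * a\<^sup>2 + 3/4, 3/2 * a, 1/4] ! k"
  have T: "chebyshev_T (Suc 0) = [:0, 1:]" "chebyshev_T (Suc (Suc 0)) = [:-1, 0, 2:]"
    "chebyshev_T (Suc (Suc (Suc 0))) = [:0, -3, 0, 4:]"
    using chebyshev_T_1 chebyshev_T_2 chebyshev_T_3 by (simp_all add: numeral_eq_Suc)
  have "[:a, 1:] ^ 3 = (\<Sum>k\<le>3. smult (?c k) (chebyshev_T k))"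
    by (simp add: numeral_3_eq_3 chebyshev_T_0 T one_pCons power2_eq_square algebra_simps)
  moreover have "(\<Sum>k\<le>3. smult (r ^ k * ?c k) (chebyshev_T k))
    = [:a ^ 3 - 3/2 * a * (r\<^sup>2 - 1), 3 * a\<^sup>2 * r - 3/4 * r * (r\<^sup>2 - 1), 3 * a * r\<^sup>2, r ^ 3:]"
    by (simp add: numeral_3_eq_3 chebyshev_T_0 T one_pCons power2_eq_square field_simps)
  ultimately show ?thesis by (simp only: chebyshev_diagonal_operator_sum)
qed

lemma hyperbolic_linear_power: "hyperbolic ([:a, 1:] ^ n)"
proof -
  have "poly (map_poly complex_of_real ([:a, 1:] ^ n)) z = (of_real a + z) ^ n" for z
  proof (induction n)
    case (Suc n)
    have "map_poly complex_of_real ([:a, 1:] * q) = [:of_real a, 1:] * map_poly complex_of_real q" for q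
      by (rule poly_eqI) (simp add: coeff_map_poly coeff_pCons split: nat.split)
    with Suc show ?case by (simp add: distrib_right)
  qed (simp add: one_pCons map_poly_pCons)
  moreover have "z \<in> \<real>" if "of_real a + z = 0" for z :: complex
    using that by (metis Reals_minus Reals_of_real add_eq_0_iff)
  ultimately show ?thesis by (simp add: hyperbolic_def)
qed

lemma not_hyperbolic_image_cube:
  fixes r :: real
  assumes "r \<notin> {-1, 0, 1}"
  shows "\<not> hyperbolic (chebyshev_diagonal_operator (\<lambda>k. r ^ k) ([:r, 1:] ^ 3))"
    (is "\<not> hyperbolic ?q")
proof
  assume hyp: "hyperbolic ?q"
  define m where "m = 3/4 * (1 - 1 / r\<^sup>2)"
  have r: "r \<noteq> 0" "r\<^sup>2 \<noteq> 1" using assms by (auto simp: power2_eq_1_iff)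
  then have "m \<noteq> 0" "m < 3/4" by (auto simp: m_def field_simps)
  then obtain u :: complex where u: "u ^ 3 = of_real m * (u + 1)" "u \<notin> \<real>"
    by (rule depressed_cubic_nonreal_root)
  have "r\<^sup>2 * m = 3/4 * (r\<^sup>2 - 1)" using r by (simp add: m_def field_simps)
  then have rm: "of_real r ^ 2 * of_real m = 3/4 * (of_real r ^ 2 - 1 :: complex)"
    by (metis (mono_tags) of_real_1 of_real_diff of_real_divide of_real_mult of_real_numeral of_real_power)
  (* In the variable u = x + 1 the image is r^3 u^3 - 3/4 r (r^2 - 1) (u + 1). *)
  have "poly (map_poly complex_of_real ?q) (u - 1)
      = of_real r ^ 3 * u ^ 3 - of_real r * (3/4 * (of_real r ^ 2 - 1)) * (u + 1)"
    unfolding chebyshev_diagonal_operator_cube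
    by (simp add: map_poly_pCons power2_eq_square power3_eq_cube field_simps)
  also have "\<dots> = 0"
    unfolding rm[symmetric] u(1) by (simp add: power2_eq_square power3_eq_cube)
  finally have root: "poly (map_poly complex_of_real ?q) (u - 1) = 0" .
  have "?q \<noteq> 0" using r unfolding chebyshev_diagonal_operator_cube by simp
  with hyp root have "u - 1 \<in> \<real>" unfolding hyperbolic_def by blast
  then have "u - 1 + 1 \<in> \<real>" by (intro Reals_add Reals_1)
  with u(2) show False by simp
qed

theorem theorem19:
  fixes r :: real
  shows "chebyshev_multiplier_sequence (\<lambda>k. r ^ k) \<longleftrightarrow> r \<in> {-1, 0, 1}"
proof
  assume "chebyshev_multiplier_sequence (\<lambda>k. r ^ k)"
  then show "r \<in> {-1, 0, 1}"
    unfolding chebyshev_multiplier_sequence_def hyperbolicity_preserving_def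
    using not_hyperbolic_image_cube hyperbolic_linear_power by blast
next
  assume "r \<in> {-1, 0, 1}"
  then consider "r = -1" | "r = 0" | "r = 1" by blast
  then show "chebyshev_multiplier_sequence (\<lambda>k. r ^ k)"
    unfolding chebyshev_multiplier_sequence_def hyperbolicity_preserving_def
  proof cases
    case 1
    then show "\<forall>p. hyperbolic p \<longrightarrow> hyperbolic (chebyshev_diagonal_operator (\<lambda>k. r ^ k) p)"
      by (simp add: chebyshev_diagonal_operator_minus_one hyperbolic_reflect)
  next
    case 2
    then show "\<forall>p. hyperbolic p \<longrightarrow> hyperbolic (chebyshev_diagonal_operator (\<lambda>k. r ^ k) p)"
      using chebyshev_diagonal_operator_zero hyperbolic_const by metis
  next
    case 3
    then show "\<forall>p. hyperbolic p \<longrightarrow> hyperbolic (chebyshev_diagonal_operator (\<lambda>k. r ^ k) p)"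
      by (simp only: chebyshev_diagonal_operator_one simp_thms)
  qed
qed

end
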